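(* \textsc{Critical Node Cut} admits a polynomial kernel with respect to the parameter $k+x$: there is a polynomial-time algorithm that transforms any instance $(G,k,x)$ into an equivalent instance $(G',k',x')$ of \textsc{Critical Node Cut} whose size is bounded by a polynomial in $k+x$.
   Context: \textsc{Critical Node Cut} (CNC): given an undirected simple graph $G$ and two nonnegative integers $k$ and $x$, decide whether there exists $C\subseteq V(G)$ with $|C|\le k$ such that $G-C$ has at most $x$ connected pairs, where a connected pair is an ordered pair $(u,v)$ of distinct vertices in the same connected component. Two instances are equivalent if one is a yes-instance iff the other is. *)

theory Defs
  imports
    "Graph_Theory.Digraph_Component"
    "HOL-Computational_Algebra.Polynomial"
begin

section \<open>Critical Node Cut\<close>

text \<open>
  A finite undirected simple graph is a finite, symmetric, loop-free digraph without parallel arcs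
  (\<^locale>\<open>pair_graph\<close>): the edge $uv$ is the pair of arcs $(u,v)$, $(v,u)$. In such a graph the
  strongly connected components are the connected components.
\<close>

type_synonym cnc_inst = "nat pair_pre_digraph \<times> nat \<times> nat"

definition cnc_instances :: "cnc_inst set" where
  "cnc_instances = {(G, k, x). pair_graph G}"

definition connected_pairs :: "('a, 'b) pre_digraph \<Rightarrow> ('a \<times> 'a) set" where
  "connected_pairs H = {(u, v). u \<noteq> v \<and> (\<exists>S \<in> pre_digraph.sccs_verts H. u \<in> S \<and> v \<in> S)}"

fun cnc_yes :: "cnc_inst \<Rightarrow> bool" where
  "cnc_yes (G, k, x) \<longleftrightarrow> (\<exists>C \<subseteq> pverts G. card C \<le> k \<and>
     card (connected_pairs (with_proj G \<restriction> (pverts G - C))) \<le> x)"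

fun cnc_param :: "cnc_inst \<Rightarrow> nat" where
  "cnc_param (G, k, x) = k + x"


section \<open>Polynomial-time computation\<close>

text \<open>
  The machine model is the WHILE language over binary trees of N. D. Jones
  (Computability and Complexity from a Programming Perspective, MIT Press 1997).
  An assignment is charged the size of the value it stores, so that within time $t$ no variable
  can hold a tree larger than the input size plus $t$; polynomial time for this measure is
  therefore polynomial time on Turing machines.
\<close>

datatype dtree = Leaf | Node dtree dtree

datatype exp = Var nat | LeafE | NodeE exp exp | Left exp | Right exp

datatype com = Skip | Assign nat exp | Seq com com | If exp com com | While exp com

type_synonym state = "nat \<Rightarrow> dtree"

fun left :: "dtree \<Rightarrow> dtree" where
  "left Leaf = Leaf"
| "left (Node a b) = a"

fun right :: "dtree \<Rightarrow> dtree" where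
  "right Leaf = Leaf"
| "right (Node a b) = b"

fun val :: "exp \<Rightarrow> state \<Rightarrow> dtree" where
  "val (Var i) s = s i"
| "val LeafE s = Leaf"
| "val (NodeE a b) s = Node (val a s) (val b s)"
| "val (Left a) s = left (val a s)"
| "val (Right a) s = right (val a s)"

text \<open>\<open>exec c s t s'\<close>: started in state \<open>s\<close>, the program \<open>c\<close> halts in state \<open>s'\<close> after time \<open>t\<close>.
  Tests are true on every tree other than \<^const>\<open>Leaf\<close>. The function \<^const>\<open>size\<close> counts the inner
  nodes of a tree.\<close>

inductive exec :: "com \<Rightarrow> state \<Rightarrow> nat \<Rightarrow> state \<Rightarrow> bool" where
  Skip: "exec Skip s 1 s"
| Assign: "exec (Assign i e) s (1 + size (val e s)) (s(i := val e s))"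
| Seq: "exec c s t s' \<Longrightarrow> exec d s' t' s'' \<Longrightarrow> exec (Seq c d) s (t + t') s''"
| IfTrue: "val e s \<noteq> Leaf \<Longrightarrow> exec c s t s' \<Longrightarrow> exec (If e c d) s (1 + t) s'"
| IfFalse: "val e s = Leaf \<Longrightarrow> exec d s t s' \<Longrightarrow> exec (If e c d) s (1 + t) s'"
| WhileFalse: "val e s = Leaf \<Longrightarrow> exec (While e c) s 1 s"
| WhileTrue: "val e s \<noteq> Leaf \<Longrightarrow> exec c s t s' \<Longrightarrow> exec (While e c) s' t' s''
    \<Longrightarrow> exec (While e c) s (1 + t + t') s''"

text \<open>Variable 0 holds the input and, in the end, the output; all other variables are initially
  \<^const>\<open>Leaf\<close>.\<close>

definition computes_within :: "com \<Rightarrow> dtree \<Rightarrow> nat \<Rightarrow> dtree \<Rightarrow> bool" where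
  "computes_within c inp b out \<longleftrightarrow>
     (\<exists>t s. exec c ((\<lambda>_. Leaf)(0 := inp)) t s \<and> t \<le> b \<and> s 0 = out)"

definition polytime_on :: "'i set \<Rightarrow> ('i \<Rightarrow> dtree) \<Rightarrow> ('i \<Rightarrow> 'i) \<Rightarrow> bool" where
  "polytime_on A enc f \<longleftrightarrow>
     (\<exists>c (p :: nat poly). \<forall>I \<in> A.
        computes_within c (enc I) (poly p (size (enc I))) (enc (f I)))"


section \<open>Encoding of instances\<close>

fun enc_list :: "dtree list \<Rightarrow> dtree" where
  "enc_list [] = Leaf"
| "enc_list (t # ts) = Node t (enc_list ts)"

definition enc_bool :: "bool \<Rightarrow> dtree" where
  "enc_bool b = (if b then Node Leaf Leaf else Leaf)"

text \<open>Binary representation, least significant bit first, without leading zeros.\<close>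

fun bits :: "nat \<Rightarrow> bool list" where
  "bits n = (if n = 0 then [] else odd n # bits (n div 2))"

declare bits.simps [simp del]

definition enc_nat :: "nat \<Rightarrow> dtree" where
  "enc_nat n = enc_list (map enc_bool (bits n))"

text \<open>The adjacency matrix, row by row, with the vertices in increasing order. Like every adjacency
  matrix it does not record the names of the vertices, which are irrelevant for the problem.\<close>

definition enc_graph :: "nat pair_pre_digraph \<Rightarrow> dtree" where
  "enc_graph G = (let vs = sorted_list_of_set (pverts G) in
     enc_list (map (\<lambda>u. enc_list (map (\<lambda>v. enc_bool ((u, v) \<in> parcs G)) vs)) vs))"

fun enc_cnc :: "cnc_inst \<Rightarrow> dtree" where
  "enc_cnc (G, k, x) = Node (enc_graph G) (Node (enc_nat k) (enc_nat x))"


section \<open>Polynomial kernels\<close>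

text \<open>The parameterized problem has instances \<open>A\<close>, yes-instances \<open>yes\<close>, and parameter \<open>par\<close>. As usual,
  both the encoding length and the parameter of the reduced instance have to be bounded; since numbers
  are written in binary, the former does not imply the latter.\<close>

definition admits_polynomial_kernel ::
  "'i set \<Rightarrow> ('i \<Rightarrow> dtree) \<Rightarrow> ('i \<Rightarrow> bool) \<Rightarrow> ('i \<Rightarrow> nat) \<Rightarrow> bool" where
  "admits_polynomial_kernel A enc yes par \<longleftrightarrow>
     (\<exists>f. polytime_on A enc f \<and>
        (\<forall>I \<in> A. f I \<in> A \<and> (yes (f I) \<longleftrightarrow> yes I)) \<and>
        (\<exists>q :: nat poly. \<forall>I \<in> A. size (enc (f I)) + par (f I) \<le> poly q (par I)))"

end

theory Submission
  imports Defs
begin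

text \<open>
  A vertex outside a solution has degree at most \<open>k + x\<close>, since all its neighbours outside the solution
  are connected to it. So the set \<open>H\<close> of vertices of larger degree lies in every solution, and one
  can pass to \<open>G - H\<close> with budget \<open>k - |H|\<close>. There, isolated vertices are irrelevant, and
  without them a yes-instance has at most \<open>k + x + k (k + x)\<close> vertices: those of the solution, those
  in a connected pair, and the others, which are adjacent to the solution.

  For the running time, functions on trees that are computed by programs in polynomial time are shown to be
  closed under composition, pairing, case distinction and folds with polynomially bounded
  intermediate results; the reduction is then written as such a function. Comparisons with \<open>k + x\<close>,
  which may be exponential in the input length, are made with \<open>min |V| (k + x)\<close> in unary.
\<close>

section \<open>A calculus of polynomial-time functions on trees\<close>

definition poly_bounded :: "(nat \<Rightarrow> nat) \<Rightarrow> bool" where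
  "poly_bounded g \<longleftrightarrow> (\<exists>p. \<forall>n. g n \<le> poly p n)"

lemma poly_mono_nat: "m \<le> n \<Longrightarrow> poly p m \<le> poly p n" for p :: "nat poly"
  by (induction p) (auto intro!: add_mono mult_mono)

lemma poly_bounded_const: "poly_bounded (\<lambda>_. c)"
  unfolding poly_bounded_def by (rule exI[of _ "[:c:]"]) simp

lemma poly_bounded_id: "poly_bounded (\<lambda>n. n)"
  unfolding poly_bounded_def by (rule exI[of _ "[:0,1:]"]) simp

lemma poly_bounded_add:
  assumes "poly_bounded g" "poly_bounded h"
  shows "poly_bounded (\<lambda>n. g n + h n)"
proof -
  from assms obtain p q where "\<And>n. g n \<le> poly p n" "\<And>n. h n \<le> poly q n"
    unfolding poly_bounded_def by blast
  then have "\<forall>n. g n + h n \<le> poly (p + q) n" by (auto intro: add_mono)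
  then show ?thesis unfolding poly_bounded_def by blast
qed

lemma poly_bounded_mult:
  assumes "poly_bounded g" "poly_bounded h"
  shows "poly_bounded (\<lambda>n. g n * h n)"
proof -
  from assms obtain p q where "\<And>n. g n \<le> poly p n" "\<And>n. h n \<le> poly q n"
    unfolding poly_bounded_def by blast
  then have "\<forall>n. g n * h n \<le> poly (p * q) n" by (auto intro: mult_mono)
  then show ?thesis unfolding poly_bounded_def by blast
qed

lemma poly_bounded_compose:
  assumes "poly_bounded g"
  shows "poly_bounded (\<lambda>n. poly p (g n))"
proof -
  from assms obtain q where "\<And>n. g n \<le> poly q n"
    unfolding poly_bounded_def by blast
  then have "\<forall>n. poly p (g n) \<le> poly (pcompose p q) n"
    by (simp add: poly_pcompose poly_mono_nat)
  then show ?thesis unfolding poly_bounded_def by blast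
qed

lemmas poly_bounded_intros =
  poly_bounded_const poly_bounded_id poly_bounded_add poly_bounded_mult
  poly_bounded_compose

section \<open>Program runs with upper bounds on the time\<close>

definition runs :: "com \<Rightarrow> state \<Rightarrow> nat \<Rightarrow> state \<Rightarrow> bool" where
  "runs c s n s' \<longleftrightarrow> (\<exists>t\<le>n. exec c s t s')"

lemma runs_Assign: "1 + size (val e s) \<le> n \<Longrightarrow> runs (Assign i e) s n (s(i := val e s))"
  unfolding runs_def using exec.Assign by blast

lemma runs_Seq: "runs c s m s' \<Longrightarrow> runs d s' n s'' \<Longrightarrow> runs (Seq c d) s (m + n) s''"
  unfolding runs_def using exec.Seq by (meson add_mono)

lemma runs_IfTrue: "val e s \<noteq> Leaf \<Longrightarrow> runs c s n s' \<Longrightarrow> runs (If e c d) s (1 + n) s'"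
  unfolding runs_def using exec.IfTrue by (meson add_left_mono)

lemma runs_IfFalse: "val e s = Leaf \<Longrightarrow> runs d s n s' \<Longrightarrow> runs (If e c d) s (1 + n) s'"
  unfolding runs_def using exec.IfFalse by (meson add_left_mono)

lemma runs_WhileFalse: "val e s = Leaf \<Longrightarrow> runs (While e c) s 1 s"
  unfolding runs_def using exec.WhileFalse by blast

lemma runs_WhileTrue:
  "val e s \<noteq> Leaf \<Longrightarrow> runs c s m s' \<Longrightarrow> runs (While e c) s' n s'' \<Longrightarrow>
    runs (While e c) s (1 + m + n) s''"
  unfolding runs_def using exec.WhileTrue by (meson add_mono add_left_mono)

lemma runs_mono: "runs c s m s' \<Longrightarrow> m \<le> n \<Longrightarrow> runs c s n s'"
  unfolding runs_def by (meson le_trans)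

text \<open>Storing a tree costs at least its size, so values grow only by time that is paid for. A
  time bound thus also bounds the size of the result.\<close>

lemma exec_size_le: "exec c s t s' \<Longrightarrow> size (s' i) \<le> size (s i) + t"
  by (induction rule: exec.induct) auto

text \<open>The program may use the variables from \<open>b\<close> on as scratch space. It must not rely on their
  initial contents, except that of \<open>b\<close> itself, which holds the argument and finally the result.\<close>

definition implements :: "nat \<Rightarrow> com \<Rightarrow> (dtree \<Rightarrow> dtree) \<Rightarrow> (nat \<Rightarrow> nat) \<Rightarrow> bool" where
  "implements b c f g \<longleftrightarrow>
     (\<forall>s. \<exists>s'. runs c s (g (size (s b))) s' \<and> s' b = f (s b) \<and> (\<forall>j<b. s' j = s j))"

text \<open>One polynomial serves every base \<open>b\<close>: subprograms are relocated above the
  variables that their caller still needs, under the same time bound.\<close>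

definition polytime_fun :: "(dtree \<Rightarrow> dtree) \<Rightarrow> bool" where
  "polytime_fun f \<longleftrightarrow> (\<exists>p. \<forall>b. \<exists>c. implements b c f (poly p))"

lemma polytime_funI:
  assumes "\<And>b. \<exists>c. implements b c f g" "poly_bounded g"
  shows "polytime_fun f"
proof -
  from assms(2) obtain p where "\<And>n. g n \<le> poly p n" unfolding poly_bounded_def by blast
  then have "implements b c f g \<Longrightarrow> implements b c f (poly p)" for b c
    unfolding implements_def by (meson runs_mono)
  with assms(1) show ?thesis unfolding polytime_fun_def by blast
qed

lemma implementsD:
  "implements b c f g \<Longrightarrow>
    \<exists>s'. runs c s (g (size (s b))) s' \<and> s' b = f (s b) \<and> (\<forall>j<b. s' j = s j)"
  unfolding implements_def by blast

lemma polytime_fun_size: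
  assumes "polytime_fun f"
  obtains p where "\<And>x. size (f x) \<le> poly p (size x)"
proof -
  from assms obtain p c where c: "implements 0 c f (poly p)"
    unfolding polytime_fun_def by blast
  \<comment> \<open>The cell initially holds the argument itself, whence \<open>[:0,1:]\<close> on
    top of the running time.\<close>
  have "size (f x) \<le> poly (p + [:0,1:]) (size x)" for x
  proof -
    obtain s' where s': "runs c (\<lambda>_. x) (poly p (size x)) s'" "s' 0 = f x"
      using implementsD[OF c, of "\<lambda>_. x"] by blast
    then obtain t where "t \<le> poly p (size x)" "exec c (\<lambda>_. x) t s'"
      unfolding runs_def by blast
    with exec_size_le[OF this(2), of 0] s'(2) show ?thesis by simp
  qed
  then show thesis by (rule that)
qed

lemma polytime_fun_exp:
  assumes "\<And>b s. val (e b) s = f (s b)" "\<And>x. size (f x) \<le> poly p (size x)"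
  shows "polytime_fun f"
proof (rule polytime_funI)
  show "poly_bounded (\<lambda>n. 1 + poly p n)" by (intro poly_bounded_intros)
  show "\<exists>c. implements b c f (\<lambda>n. 1 + poly p n)" for b
  proof
    show "implements b (Assign b (e b)) f (\<lambda>n. 1 + poly p n)"
      unfolding implements_def
    proof
      fix s :: state
      have "runs (Assign b (e b)) s (1 + poly p (size (s b))) (s(b := val (e b) s))"
        by (rule runs_Assign) (simp add: assms)
      then show "\<exists>s'. runs (Assign b (e b)) s (1 + poly p (size (s b))) s' \<and> s' b = f (s b)
          \<and> (\<forall>j<b. s' j = s j)"
        by (intro exI[of _ "s(b := val (e b) s)"]) (simp add: assms(1))
    qed
  qed
qed

lemma size_left_le: "size (left t) \<le> size t" and size_right_le: "size (right t) \<le> size t"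
  by (cases t; simp)+

lemma polytime_fun_id: "polytime_fun (\<lambda>x. x)"
  by (rule polytime_fun_exp[where e = Var and p = "[:0,1:]"]) auto

lemma polytime_fun_Leaf: "polytime_fun (\<lambda>_. Leaf)"
  by (rule polytime_fun_exp[where e = "\<lambda>_. LeafE" and p = 0]) auto

lemma polytime_fun_left_basic: "polytime_fun left"
  by (rule polytime_fun_exp[where e = "\<lambda>b. Left (Var b)" and p = "[:0,1:]"])
    (auto simp: size_left_le)

lemma polytime_fun_right_basic: "polytime_fun right"
  by (rule polytime_fun_exp[where e = "\<lambda>b. Right (Var b)" and p = "[:0,1:]"])
    (auto simp: size_right_le)

lemma polytime_fun_compose:
  assumes "polytime_fun f" "polytime_fun g"
  shows "polytime_fun (\<lambda>x. f (g x))"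
proof -
  from assms(1) obtain p where p: "\<And>b. \<exists>c. implements b c f (poly p)"
    unfolding polytime_fun_def by blast
  from assms(2) obtain q where q: "\<And>b. \<exists>c. implements b c g (poly q)"
    unfolding polytime_fun_def by blast
  from polytime_fun_size[OF assms(2)] obtain r where r: "\<And>x. size (g x) \<le> poly r (size x)"
    by blast
  show ?thesis
  proof (rule polytime_funI)
    show "poly_bounded (\<lambda>n. poly q n + poly p (poly r n))" by (intro poly_bounded_intros)
    show "\<exists>c. implements b c (\<lambda>x. f (g x)) (\<lambda>n. poly q n + poly p (poly r n))" for b
    proof -
      from p q obtain c d where c: "implements b c f (poly p)" and d: "implements b d g (poly q)"
        by meson
      have "implements b (Seq d c) (\<lambda>x. f (g x)) (\<lambda>n. poly q n + poly p (poly r n))"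
        unfolding implements_def
      proof
        fix s :: state
        obtain s' where s': "runs d s (poly q (size (s b))) s'" "s' b = g (s b)"
            "\<forall>j<b. s' j = s j"
          using implementsD[OF d] by blast
        obtain s'' where s'': "runs c s' (poly p (size (s' b))) s''" "s'' b = f (s' b)"
            "\<forall>j<b. s'' j = s' j"
          using implementsD[OF c] by blast
        have "runs c s' (poly p (poly r (size (s b)))) s''"
          by (rule runs_mono[OF s''(1)]) (simp add: s' r poly_mono_nat)
        with runs_Seq[OF s'(1)] s' s'' show "\<exists>s''. runs (Seq d c) s
            (poly q (size (s b)) + poly p (poly r (size (s b)))) s'' \<and> s'' b = f (g (s b)) \<and>
            (\<forall>j<b. s'' j = s j)"
          by fastforce
      qed
      then show ?thesis by blast
    qed
  qed
qed

lemmas polytime_fun_left = polytime_fun_compose[OF polytime_fun_left_basic]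
lemmas polytime_fun_right = polytime_fun_compose[OF polytime_fun_right_basic]

text \<open>Cell \<open>b\<close> keeps the argument while both components are computed; basing the
  second program at \<open>b + 2\<close> protects the first result in \<open>b + 1\<close>.\<close>

lemma polytime_fun_Node:
  assumes "polytime_fun f" "polytime_fun g"
  shows "polytime_fun (\<lambda>x. Node (f x) (g x))"
proof -
  from assms(1) obtain p where p: "\<And>b. \<exists>c. implements b c f (poly p)"
    unfolding polytime_fun_def by blast
  from assms(2) obtain q where q: "\<And>b. \<exists>c. implements b c g (poly q)"
    unfolding polytime_fun_def by blast
  from polytime_fun_size[OF assms(1)] obtain p' where p': "\<And>x. size (f x) \<le> poly p' (size x)"
    by blast
  from polytime_fun_size[OF assms(2)] obtain q' where q': "\<And>x. size (g x) \<le> poly q' (size x)"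
    by blast
  let ?n = "\<lambda>n. (1 + n) + (poly p n + ((1 + n) + (poly q n + (2 + (poly p' n + poly q' n)))))"
  show ?thesis
  proof (rule polytime_funI)
    show "poly_bounded ?n" by (intro poly_bounded_intros)
    show "\<exists>c. implements b c (\<lambda>x. Node (f x) (g x)) ?n" for b
    proof -
      from p obtain c where c: "implements (b + 1) c f (poly p)" by meson
      from q obtain d where d: "implements (b + 2) d g (poly q)" by meson
      let ?c = "Seq (Assign (b + 1) (Var b)) (Seq c (Seq (Assign (b + 2) (Var b)) (Seq d
        (Assign b (NodeE (Var (b + 1)) (Var (b + 2)))))))"
      have "implements b ?c (\<lambda>x. Node (f x) (g x)) ?n"
        unfolding implements_def
      proof
        fix s :: state
        let ?s1 = "s(b + 1 := s b)"
        have 1: "runs (Assign (b + 1) (Var b)) s (1 + size (s b)) ?s1"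
          using runs_Assign[of "Var b" s _ "b + 1"] by simp
        obtain s2 where 2: "runs c ?s1 (poly p (size (s b))) s2" "s2 (b + 1) = f (s b)"
            "\<forall>j<b. s2 j = s j" "s2 b = s b"
          using implementsD[OF c, of ?s1] by auto
        let ?s3 = "s2(b + 2 := s b)"
        have 3: "runs (Assign (b + 2) (Var b)) s2 (1 + size (s b)) ?s3"
          using runs_Assign[of "Var b" s2 _ "b + 2"] 2 by simp
        obtain s4 where 4: "runs d ?s3 (poly q (size (s b))) s4" "s4 (b + 2) = g (s b)"
            "\<forall>j<b. s4 j = s j" "s4 (b + 1) = f (s b)"
          using 2 implementsD[OF d, of ?s3] by auto
        let ?s5 = "s4(b := Node (f (s b)) (g (s b)))"
        have 5: "runs (Assign b (NodeE (Var (b + 1)) (Var (b + 2)))) s4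
            (2 + (poly p' (size (s b)) + poly q' (size (s b)))) ?s5"
          using runs_Assign[of "NodeE (Var (b + 1)) (Var (b + 2))" s4 _ b] 4
            p'[of "s b"] q'[of "s b"] by auto
        have "runs ?c s (?n (size (s b))) ?s5"
          by (intro runs_Seq[OF 1] runs_Seq[OF 2(1)] runs_Seq[OF 3] runs_Seq[OF 4(1)] 5)
        then show "\<exists>s'. runs ?c s (?n (size (s b))) s' \<and> s' b = Node (f (s b)) (g (s b)) \<and>
            (\<forall>j<b. s' j = s j)"
          using 4 by (intro exI[of _ ?s5]) auto
      qed
      then show ?thesis by blast
    qed
  qed
qed

lemma polytime_fun_const: "polytime_fun (\<lambda>_. t)"
  by (induction t) (auto intro: polytime_fun_Leaf polytime_fun_Node)

text \<open>The condition is evaluated on a copy in \<open>b + 1\<close>, which leaves the argument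
  in \<open>b\<close> for the chosen branch.\<close>

lemma polytime_fun_if_Leaf:
  assumes "polytime_fun f" "polytime_fun g" "polytime_fun h"
  shows "polytime_fun (\<lambda>x. if f x = Leaf then g x else h x)"
proof -
  from assms(1) obtain p where p: "\<And>b. \<exists>c. implements b c f (poly p)"
    unfolding polytime_fun_def by blast
  from assms(2) obtain q where q: "\<And>b. \<exists>c. implements b c g (poly q)"
    unfolding polytime_fun_def by blast
  from assms(3) obtain r where r: "\<And>b. \<exists>c. implements b c h (poly r)"
    unfolding polytime_fun_def by blast
  let ?n = "\<lambda>n. (1 + n) + (poly p n + (1 + (poly q n + poly r n)))"
  show ?thesis
  proof (rule polytime_funI)
    show "poly_bounded ?n" by (intro poly_bounded_intros)
    show "\<exists>c. implements b c (\<lambda>x. if f x = Leaf then g x else h x) ?n" for b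
    proof -
      from p obtain c where c: "implements (b + 1) c f (poly p)" by meson
      from q obtain d where d: "implements b d g (poly q)" by meson
      from r obtain e where e: "implements b e h (poly r)" by meson
      let ?c = "Seq (Assign (b + 1) (Var b)) (Seq c (If (Var (b + 1)) e d))"
      have "implements b ?c (\<lambda>x. if f x = Leaf then g x else h x) ?n"
        unfolding implements_def
      proof
        fix s :: state
        let ?s1 = "s(b + 1 := s b)"
        have 1: "runs (Assign (b + 1) (Var b)) s (1 + size (s b)) ?s1"
          using runs_Assign[of "Var b" s _ "b + 1"] by simp
        obtain s2 where 2: "runs c ?s1 (poly p (size (s b))) s2" "s2 (b + 1) = f (s b)"
            "\<forall>j<b. s2 j = s j" "s2 b = s b"
          using implementsD[OF c, of ?s1] by auto
        obtain s3 where 3: "runs (If (Var (b + 1)) e d) s2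
            (1 + (poly q (size (s b)) + poly r (size (s b)))) s3"
            "s3 b = (if f (s b) = Leaf then g (s b) else h (s b))" "\<forall>j<b. s3 j = s j"
        proof (cases "f (s b) = Leaf")
          case True
          obtain s3 where "runs d s2 (poly q (size (s b))) s3" "s3 b = g (s b)"
              "\<forall>j<b. s3 j = s j"
            using implementsD[OF d, of s2] 2 by metis
          then show thesis
            using True 2 by (intro that[of s3] runs_IfFalse) (auto elim: runs_mono)
        next
          case False
          obtain s3 where "runs e s2 (poly r (size (s b))) s3" "s3 b = h (s b)"
              "\<forall>j<b. s3 j = s j"
            using implementsD[OF e, of s2] 2 by metis
          then show thesis
            using False 2 by (intro that[of s3] runs_IfTrue) (auto elim: runs_mono)
        qed
        have "runs ?c s (?n (size (s b))) s3"
          by (intro runs_Seq[OF 1] runs_Seq[OF 2(1)] 3)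
        then show "\<exists>s'. runs ?c s (?n (size (s b))) s' \<and>
            s' b = (if f (s b) = Leaf then g (s b) else h (s b)) \<and> (\<forall>j<b. s' j = s j)"
          using 3 by (intro exI[of _ s3]) auto
      qed
      then show ?thesis by blast
    qed
  qed
qed

lemmas polytime_fun_intros =
  polytime_fun_id polytime_fun_const polytime_fun_left polytime_fun_right polytime_fun_Node
  polytime_fun_if_Leaf

section \<open>Folds along the right spine of a tree\<close>

fun tfoldl :: "(dtree \<Rightarrow> dtree \<Rightarrow> dtree) \<Rightarrow> dtree \<Rightarrow> dtree \<Rightarrow> dtree" where
  "tfoldl h Leaf a = a"
| "tfoldl h (Node l r) a = tfoldl h r (h l a)"

text \<open>\<open>b\<close> holds the parameter, \<open>b + 1\<close> the remaining list,
  \<open>b + 2\<close> the accumulator, \<open>b + 3\<close> the packed argument of the step.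
  \<open>T\<close> bounds one iteration. The size hypothesis ranges over all lists that are not
  larger, so that it survives the induction.\<close>

lemma runs_fold_loop:
  fixes b N L B :: nat and p :: "nat poly"
  defines "T \<equiv> (3 + (N + (L + B))) + (poly p (2 + (N + (L + B))) + ((1 + B) + (1 + L)))"
  assumes c: "implements (b + 3) c (\<lambda>z. h (left z) (left (right z)) (right (right z))) (poly p)"
    and "size (s b) \<le> N" "size (s (b + 1)) \<le> L"
    and "\<And>l. size l \<le> size (s (b + 1)) \<Longrightarrow> size (tfoldl (h (s b)) l (s (b + 2))) \<le> B"
  shows "\<exists>s'. runs (While (Var (b + 1)) (Seq
      (Assign (b + 3) (NodeE (Var b) (NodeE (Left (Var (b + 1))) (Var (b + 2))))) (Seq c (Seq
      (Assign (b + 2) (Var (b + 3))) (Assign (b + 1) (Right (Var (b + 1)))))))) s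
      (size (s (b + 1)) * (1 + T) + 1) s' \<and>
      s' (b + 2) = tfoldl (h (s b)) (s (b + 1)) (s (b + 2)) \<and> (\<forall>j<b. s' j = s j)"
    (is "\<exists>s'. runs (While _ ?body) _ _ _ \<and> _")
  using assms(3-)
proof (induction "s (b + 1)" arbitrary: s)
  case Leaf
  from Leaf(1)[symmetric] show ?case
    by (intro exI[of _ s]) (auto intro: runs_mono[OF runs_WhileFalse])
next
  case (Node l r)
  let ?x = "s b" and ?a = "s (b + 2)"
  note eq = Node.hyps(3)[symmetric]
  \<comment> \<open>The current and the next accumulator are the folds over \<open>Leaf\<close> and
    \<open>Node l Leaf\<close>, hence covered by the hypothesis.\<close>
  have a: "size ?a \<le> B" using Node.prems(3)[of Leaf] by simp
  have ha: "size (h ?x l ?a) \<le> B" using Node.prems(3)[of "Node l Leaf"] eq by simp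
  have sz: "size l + size r + 1 \<le> L" using Node.prems(2) eq by simp
  let ?s1 = "s(b + 3 := Node ?x (Node l ?a))"
  have 1: "runs (Assign (b + 3) (NodeE (Var b) (NodeE (Left (Var (b + 1))) (Var (b + 2))))) s
      (3 + (N + (L + B))) ?s1"
    using runs_Assign[of "NodeE (Var b) (NodeE (Left (Var (b + 1))) (Var (b + 2)))" s _ "b + 3"]
      eq a sz Node.prems(1) by simp
  obtain s2 where s2: "runs c ?s1 (poly p (size (?s1 (b + 3)))) s2" "s2 (b + 3) = h ?x l ?a"
      "\<forall>j<b + 3. s2 j = ?s1 j"
    using implementsD[OF c, of ?s1] by auto
  have "poly p (size (?s1 (b + 3))) \<le> poly p (2 + (N + (L + B)))"
    by (rule poly_mono_nat) (use a sz Node.prems(1) in simp)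
  with s2 have 2: "runs c ?s1 (poly p (2 + (N + (L + B)))) s2" "s2 (b + 3) = h ?x l ?a"
      "\<forall>j<b + 3. s2 j = s j"
    by (auto intro: runs_mono)
  let ?s3 = "s2(b + 2 := h ?x l ?a)"
  have 3: "runs (Assign (b + 2) (Var (b + 3))) s2 (1 + B) ?s3"
    using runs_Assign[of "Var (b + 3)" s2 _ "b + 2"] 2 ha by simp
  let ?s4 = "?s3(b + 1 := r)"
  have 4: "runs (Assign (b + 1) (Right (Var (b + 1)))) ?s3 (1 + L) ?s4"
    using runs_Assign[of "Right (Var (b + 1))" ?s3 _ "b + 1"] 2(3) eq sz by simp
  have body: "runs ?body s T ?s4"
    unfolding T_def by (intro runs_Seq[OF 1] runs_Seq[OF 2(1)] runs_Seq[OF 3] 4)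
  \<comment> \<open>Prepending \<open>l\<close> turns a fold from the new accumulator into one from
    the old.\<close>
  have bd: "size (tfoldl (h ?x) l' (h ?x l ?a)) \<le> B" if "size l' \<le> size r" for l'
    using Node.prems(3)[of "Node l l'"] eq that by simp
  from Node.hyps(2)[of ?s4] obtain s5 where 5: "runs (While (Var (b + 1)) ?body) ?s4
      (size r * (1 + T) + 1) s5" "s5 (b + 2) = tfoldl (h ?x) r (h ?x l ?a)" "\<forall>j<b. s5 j = s j"
    using 2(3) Node.prems sz bd by (auto simp: fun_upd_def)
  have "runs (While (Var (b + 1)) ?body) s (1 + T + (size r * (1 + T) + 1)) s5"
    by (rule runs_WhileTrue[OF _ body 5(1)]) (use eq in simp)
  then have "runs (While (Var (b + 1)) ?body) s (size (s (b + 1)) * (1 + T) + 1) s5"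
    by (rule runs_mono) (use eq in \<open>simp add: algebra_simps\<close>)
  with 5 eq show ?case by auto
qed

text \<open>List and start value are computed as one pair at base \<open>b + 1\<close> and then
  unpacked; cell \<open>b\<close> keeps \<open>x\<close>, on which the step may depend.\<close>

lemma polytime_fun_tfoldl:
  assumes h: "polytime_fun (\<lambda>z. h (left z) (left (right z)) (right (right z)))"
    and f: "polytime_fun f" and g: "polytime_fun g"
    and bound: "\<And>x l. size l \<le> size (f x) \<Longrightarrow> size (tfoldl (h x) l (g x)) \<le> poly q (size x)"
  shows "polytime_fun (\<lambda>x. tfoldl (h x) (f x) (g x))"
proof -
  let ?h = "\<lambda>z. h (left z) (left (right z)) (right (right z))"
  from h obtain p where p: "\<And>b. \<exists>c. implements b c ?h (poly p)"
    unfolding polytime_fun_def by blast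
  from polytime_fun_size[OF f] obtain r where r: "\<And>x. size (f x) \<le> poly r (size x)"
    by blast
  have fg: "polytime_fun (\<lambda>x. Node (f x) (g x))" by (rule polytime_fun_Node[OF f g])
  from fg obtain p' where p': "\<And>b. \<exists>c. implements b c (\<lambda>x. Node (f x) (g x)) (poly p')"
    unfolding polytime_fun_def by blast
  from polytime_fun_size[OF fg] obtain r' where
    r': "\<And>x. size (Node (f x) (g x)) \<le> poly r' (size x)" by blast
  let ?T = "\<lambda>N. (3 + (N + (poly r N + poly q N))) + (poly p (2 + (N + (poly r N + poly q N))) +
    ((1 + poly q N) + (1 + poly r N)))"
  let ?n = "\<lambda>n. (1 + n) + (poly p' n + ((1 + poly r' n) + ((1 + poly r' n) +
    ((poly r n * (1 + ?T n) + 1) + (1 + poly q n)))))"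
  show ?thesis
  proof (rule polytime_funI)
    show "poly_bounded ?n"
      by (intro poly_bounded_intros)
    show "\<exists>c. implements b c (\<lambda>x. tfoldl (h x) (f x) (g x)) ?n" for b
    proof -
      from p obtain c where c: "implements (b + 3) c ?h (poly p)" by meson
      from p' obtain d where d: "implements (b + 1) d (\<lambda>x. Node (f x) (g x)) (poly p')" by meson
      let ?loop = "While (Var (b + 1)) (Seq
        (Assign (b + 3) (NodeE (Var b) (NodeE (Left (Var (b + 1))) (Var (b + 2))))) (Seq c (Seq
        (Assign (b + 2) (Var (b + 3))) (Assign (b + 1) (Right (Var (b + 1)))))))"
      let ?c = "Seq (Assign (b + 1) (Var b)) (Seq d (Seq (Assign (b + 2) (Right (Var (b + 1))))
        (Seq (Assign (b + 1) (Left (Var (b + 1)))) (Seq ?loop (Assign b (Var (b + 2)))))))"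
      have "implements b ?c (\<lambda>x. tfoldl (h x) (f x) (g x)) ?n"
        unfolding implements_def
      proof
        fix s :: state
        let ?x = "s b"
        let ?s1 = "s(b + 1 := ?x)"
        have 1: "runs (Assign (b + 1) (Var b)) s (1 + size ?x) ?s1"
          using runs_Assign[of "Var b" s _ "b + 1"] by simp
        obtain s2 where 2: "runs d ?s1 (poly p' (size ?x)) s2" "s2 (b + 1) = Node (f ?x) (g ?x)"
            "\<forall>j<b. s2 j = s j" "s2 b = ?x"
          using implementsD[OF d, of ?s1] by auto
        let ?s3 = "s2(b + 2 := g ?x)"
        have 3: "runs (Assign (b + 2) (Right (Var (b + 1)))) s2 (1 + poly r' (size ?x)) ?s3"
          using runs_Assign[of "Right (Var (b + 1))" s2 _ "b + 2"] 2 r'[of ?x] by simp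
        let ?s4 = "?s3(b + 1 := f ?x)"
        have 4: "runs (Assign (b + 1) (Left (Var (b + 1)))) ?s3 (1 + poly r' (size ?x)) ?s4"
          using runs_Assign[of "Left (Var (b + 1))" ?s3 _ "b + 1"] 2 r'[of ?x] by simp
        have "\<exists>s'. runs ?loop ?s4 (size (?s4 (b + 1)) * (1 + ?T (size ?x)) + 1) s' \<and>
            s' (b + 2) = tfoldl (h (?s4 b)) (?s4 (b + 1)) (?s4 (b + 2)) \<and> (\<forall>j<b. s' j = ?s4 j)"
          by (rule runs_fold_loop[OF c]) (use 2 r bound in auto)
        then obtain s5 where 5: "runs ?loop ?s4 (size (f ?x) * (1 + ?T (size ?x)) + 1) s5"
            "s5 (b + 2) = tfoldl (h ?x) (f ?x) (g ?x)" "\<forall>j<b. s5 j = s j"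
          using 2 by (auto simp: fun_upd_def)
        have 55: "runs ?loop ?s4 (poly r (size ?x) * (1 + ?T (size ?x)) + 1) s5"
          by (rule runs_mono[OF 5(1)]) (intro add_right_mono mult_le_mono1 r)
        let ?s6 = "s5(b := tfoldl (h ?x) (f ?x) (g ?x))"
        have 6: "runs (Assign b (Var (b + 2))) s5 (1 + poly q (size ?x)) ?s6"
          using runs_Assign[of "Var (b + 2)" s5 _ b] 5 bound[of "f ?x" ?x] by simp
        have "runs ?c s (?n (size ?x)) ?s6"
          by (intro runs_Seq[OF 1] runs_Seq[OF 2(1)] runs_Seq[OF 3] runs_Seq[OF 4]
              runs_Seq[OF 55] 6)
        then show "\<exists>s'. runs ?c s (?n (size ?x)) s' \<and> s' b = tfoldl (h ?x) (f ?x) (g ?x) \<and>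
            (\<forall>j<b. s' j = s j)"
          using 5 by (intro exI[of _ ?s6]) auto
      qed
      then show ?thesis by blast
    qed
  qed
qed

section \<open>Right folds by reversal\<close>

fun tfoldr :: "(dtree \<Rightarrow> dtree \<Rightarrow> dtree) \<Rightarrow> dtree \<Rightarrow> dtree \<Rightarrow> dtree" where
  "tfoldr h Leaf a = a"
| "tfoldr h (Node l r) a = h l (tfoldr h r a)"

definition trev :: "dtree \<Rightarrow> dtree" where
  "trev t = tfoldl Node t Leaf"

lemma size_tfoldl_Node: "size (tfoldl Node t a) = size t + size a"
  by (induction t arbitrary: a) auto

lemma size_trev: "size (trev t) = size t"
  by (simp add: trev_def size_tfoldl_Node)

text \<open>Reversing \<open>t\<close> onto \<open>u\<close> brings the last element of
  \<open>t\<close> to the front, so the left fold visits \<open>t\<close> in the order of a right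
  fold before it reaches \<open>u\<close>.\<close>

lemma tfoldl_tfoldl_Node: "tfoldl h (tfoldl Node t u) a = tfoldl h u (tfoldr h t a)"
  by (induction t arbitrary: u) auto

lemma tfoldl_trev: "tfoldl h (trev t) a = tfoldr h t a"
  by (simp add: trev_def tfoldl_tfoldl_Node)

lemma trev_trev: "trev (trev t) = t"
proof -
  have "tfoldr Node t Leaf = t" by (induction t) auto
  then show ?thesis by (simp add: trev_def tfoldl_tfoldl_Node)
qed

lemma polytime_fun_trev:
  assumes "polytime_fun f"
  shows "polytime_fun (\<lambda>x. trev (f x))"
proof -
  have "polytime_fun (\<lambda>x. tfoldl Node x Leaf)"
    by (rule polytime_fun_tfoldl[where q = "[:0,1:]" and f = "\<lambda>x. x" and h = "\<lambda>_. Node"])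
      ((intro polytime_fun_intros)+, simp add: size_tfoldl_Node)
  from polytime_fun_compose[OF this assms] show ?thesis by (simp add: trev_def)
qed

text \<open>The loop consumes lists from the front, so the list is reversed first. Reversal is a
  size-preserving involution, which carries the bound over.\<close>

lemma polytime_fun_tfoldr:
  assumes h: "polytime_fun (\<lambda>z. h (left z) (left (right z)) (right (right z)))"
    and f: "polytime_fun f" and g: "polytime_fun g"
    and bound: "\<And>x l. size l \<le> size (f x) \<Longrightarrow> size (tfoldr (h x) l (g x)) \<le> poly q (size x)"
  shows "polytime_fun (\<lambda>x. tfoldr (h x) (f x) (g x))"
proof -
  have "polytime_fun (\<lambda>x. tfoldl (h x) (trev (f x)) (g x))"
  proof (rule polytime_fun_tfoldl[OF h polytime_fun_trev[OF f] g])
    fix x l :: dtree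
    assume "size l \<le> size (trev (f x))"
    then show "size (tfoldl (h x) l (g x)) \<le> poly q (size x)"
      using bound[of "trev l" x] tfoldl_trev[of "h x" "trev l" "g x"]
      by (simp add: size_trev trev_trev)
  qed
  then show ?thesis by (simp add: tfoldl_trev)
qed

text \<open>A potential \<open>\<Phi>\<close> of the accumulator that grows polynomially in each step bounds a fold;
  the plain size would not do, since the binary predecessor of a number may be larger as a tree
  than the number.\<close>

lemma polytime_fun_tfoldr_potential:
  fixes \<Phi> :: "dtree \<Rightarrow> nat"
  assumes h: "polytime_fun (\<lambda>z. h (left z) (left (right z)) (right (right z)))"
    and f: "polytime_fun f" and g: "polytime_fun g"
    and step: "\<And>x l a. \<Phi> (h x l a) \<le> \<Phi> a + poly r (size x + size l)"
    and lower: "\<And>a. size a \<le> \<Phi> a" and upper: "\<And>a. \<Phi> a \<le> poly r' (size a)"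
  shows "polytime_fun (\<lambda>x. tfoldr (h x) (f x) (g x))"
proof -
  from polytime_fun_size[OF f] obtain p where p: "\<And>x. size (f x) \<le> poly p (size x)" by blast
  from polytime_fun_size[OF g] obtain p' where p': "\<And>x. size (g x) \<le> poly p' (size x)" by blast
  have fold: "\<Phi> (tfoldr (h x) l a) \<le> \<Phi> a + size l * poly r (size x + size l)" for x l a
  proof (induction l)
    case (Node l1 l2)
    let ?P = "poly r (size x + size (Node l1 l2))"
    have mono: "poly r (size x + size l1) \<le> ?P" "poly r (size x + size l2) \<le> ?P"
      by (auto intro: poly_mono_nat)
    have "\<Phi> (tfoldr (h x) (Node l1 l2) a) \<le> \<Phi> (tfoldr (h x) l2 a) + poly r (size x + size l1)"
      using step by simp
    also have "\<dots> \<le> (\<Phi> a + size l2 * ?P) + ?P"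
      using Node.IH(2) mono mult_le_mono2[OF mono(2), of "size l2"] by linarith
    also have "\<dots> \<le> \<Phi> a + size (Node l1 l2) * ?P" by simp
    finally show ?case .
  qed simp
  have "poly_bounded (\<lambda>n. poly r' (poly p' n) + poly p n * poly r (n + poly p n))"
    by (intro poly_bounded_intros)
  then obtain q where q: "\<And>n. poly r' (poly p' n) + poly p n * poly r (n + poly p n) \<le> poly q n"
    unfolding poly_bounded_def by blast
  show ?thesis
  proof (rule polytime_fun_tfoldr[OF h f g])
    fix x l :: dtree
    assume "size l \<le> size (f x)"
    then have l: "size l \<le> poly p (size x)" using p le_trans by blast
    have "size (tfoldr (h x) l (g x)) \<le> \<Phi> (g x) + size l * poly r (size x + size l)"
      using lower fold le_trans by blast
    also have "\<Phi> (g x) \<le> poly r' (poly p' (size x))"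
      using upper[of "g x"] poly_mono_nat[OF p'[of x]] le_trans by blast
    also have "size l * poly r (size x + size l)
        \<le> poly p (size x) * poly r (size x + poly p (size x))"
      using l by (intro mult_mono poly_mono_nat add_mono) auto
    also note q
    finally show "size (tfoldr (h x) l (g x)) \<le> poly q (size x)" by simp
  qed
qed

lemmas polytime_fun_tfoldr_size =
  polytime_fun_tfoldr_potential[where \<Phi> = size and r' = "[:0,1:]", simplified]

lemma polytime_fun_compose2:
  assumes "polytime_fun (\<lambda>z. F (left z) (right z))" "polytime_fun f" "polytime_fun g"
  shows "polytime_fun (\<lambda>x. F (f x) (g x))"
  using polytime_fun_compose[OF assms(1) polytime_fun_Node[OF assms(2,3)]] by simp

text \<open>Base 0 matches the convention that variable 0 is both input and output.\<close>

lemma polytime_onI: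
  assumes F: "polytime_fun F" and enc: "\<And>I. I \<in> A \<Longrightarrow> F (enc I) = enc (f I)"
  shows "polytime_on A enc f"
proof -
  from F obtain p c where c: "implements 0 c F (poly p)"
    unfolding polytime_fun_def by blast
  have "computes_within c (enc I) (poly p (size (enc I))) (enc (f I))" if "I \<in> A" for I
    using c that enc unfolding implements_def computes_within_def runs_def
    by (metis fun_upd_same)
  then show ?thesis unfolding polytime_on_def by blast
qed


section \<open>The reduction on encoded instances\<close>

definition tmap :: "(dtree \<Rightarrow> dtree) \<Rightarrow> dtree \<Rightarrow> dtree" where
  "tmap F t = tfoldr (\<lambda>l a. Node (F l) a) t Leaf"

definition tfilter :: "(dtree \<Rightarrow> dtree) \<Rightarrow> dtree \<Rightarrow> dtree" where
  "tfilter P t = tfoldr (\<lambda>l a. if P l = Leaf then a else Node l a) t Leaf"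

text \<open>The right fold consumes the reversal of the second list, kept in the left component of the
  accumulator.\<close>

definition tzip :: "dtree \<Rightarrow> dtree \<Rightarrow> dtree" where
  "tzip s t = right (tfoldr
     (\<lambda>l a. Node (right (left a)) (Node (Node l (left (left a))) (right a)))
     s (Node (trev t) Leaf))"

lemma tmap_enc_list: "tmap F (enc_list (map f us)) = enc_list (map (\<lambda>u. F (f u)) us)"
  unfolding tmap_def by (induction us) auto

lemma tfilter_enc_list:
  "tfilter P (enc_list (map f us)) = enc_list (map f (filter (\<lambda>u. P (f u) \<noteq> Leaf) us))"
  unfolding tfilter_def by (induction us) auto

lemma tfoldl_Node_enc_list: "tfoldl Node (enc_list ts) (enc_list us) = enc_list (rev ts @ us)"
proof (induction ts arbitrary: us)
  case (Cons t ts)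
  from Cons.IH[of "t # us"] show ?case by simp
qed simp

lemma trev_enc_list: "trev (enc_list ts) = enc_list (rev ts)"
  using tfoldl_Node_enc_list[of ts "[]"] by (simp add: trev_def)

lemma tzip_enc_list:
  "tzip (enc_list (map f us)) (enc_list (map g us)) = enc_list (map (\<lambda>u. Node (f u) (g u)) us)"
proof -
  \<comment> \<open>An arbitrary \<open>ts\<close> follows the reversed list: in the induction it
    starts with the partner of the element that the right fold visits last.\<close>
  have "tfoldr (\<lambda>l a. Node (right (left a)) (Node (Node l (left (left a))) (right a)))
      (enc_list (map f us)) (Node (enc_list (rev (map g us) @ ts)) Leaf)
      = Node (enc_list ts) (enc_list (map (\<lambda>u. Node (f u) (g u)) us))" for ts
    by (induction us arbitrary: ts) auto
  from this[of "[]"] show ?thesis by (simp add: tzip_def trev_enc_list)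
qed

lemma polytime_fun_tmap:
  assumes F: "polytime_fun (\<lambda>z. F (left z) (right z))" and f: "polytime_fun f"
  shows "polytime_fun (\<lambda>x. tmap (F x) (f x))"
proof -
  from polytime_fun_size[OF F] obtain p where "\<And>z. size (F (left z) (right z)) \<le> poly p (size z)"
    by blast
  from this[of "Node _ _"] have p: "size (F x l) \<le> poly p (size x + size l + 1)" for x l by simp
  show ?thesis
    unfolding tmap_def
  \<comment> \<open>The new spine node contributes 1, and \<open>[:1,1:]\<close> accounts for the
    node that packs \<open>x\<close> and \<open>l\<close>.\<close>
  proof (rule polytime_fun_tfoldr_size[where r = "1 + pcompose p [:1,1:]"])
    show "polytime_fun (\<lambda>z. Node (F (left z) (left (right z))) (right (right z)))"
      by (intro polytime_fun_intros polytime_fun_compose2[OF F])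
    show "size (Node (F x l) a) \<le> size a + poly (1 + pcompose p [:1,1:]) (size x + size l)"
      for x l a
      using p[of x l] by (simp add: poly_pcompose)
  qed (intro f polytime_fun_intros)+
qed

lemma polytime_fun_tfilter:
  assumes P: "polytime_fun (\<lambda>z. P (left z) (right z))" and f: "polytime_fun f"
  shows "polytime_fun (\<lambda>x. tfilter (P x) (f x))"
  unfolding tfilter_def
  by (rule polytime_fun_tfoldr_size[where r = "[:1,1:]"])
    ((intro f polytime_fun_intros polytime_fun_compose2[OF P])+, simp)

lemma polytime_fun_tzip:
  assumes f: "polytime_fun f" and g: "polytime_fun g"
  shows "polytime_fun (\<lambda>x. tzip (f x) (g x))"
proof -
  \<comment> \<open>The step rearranges disjoint parts of the accumulator; three new nodes and
    \<open>l\<close> give the increment \<open>[:3,1:]\<close>.\<close>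
  have le: "size (right (left a)) + size (left (left a)) + size (right a) \<le> size a" for a
    by (cases a; cases "left a") auto
  show ?thesis
    unfolding tzip_def
    by (intro polytime_fun_right polytime_fun_tfoldr_size[where r = "[:3,1:]"])
      ((intro f polytime_fun_intros polytime_fun_trev g)+,
        use le in \<open>simp add: algebra_simps trans_le_add2\<close>)
qed


subsection \<open>Numbers\<close>

primrec unary :: "nat \<Rightarrow> dtree" where
  "unary 0 = Leaf"
| "unary (Suc n) = Node Leaf (unary n)"

lemma unary_eq_Leaf_iff [simp]: "unary n = Leaf \<longleftrightarrow> n = 0"
  by (cases n) auto

lemma right_unary [simp]: "right (unary n) = unary (n - 1)"
  by (cases n) auto

text \<open>Binary predecessor with borrow: low-order zeros become ones up to the first one, which
  becomes zero, or vanishes if it is the top bit, so that no leading zero arises.\<close>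

fun tdec :: "dtree \<Rightarrow> dtree" where
  "tdec Leaf = Leaf"
| "tdec (Node l r) = (if l = Leaf then Node (Node Leaf Leaf) (tdec r)
     else if r = Leaf then Leaf else Node Leaf r)"

lemma enc_nat_0 [simp]: "enc_nat 0 = Leaf"
  by (simp add: enc_nat_def bits.simps)

lemma enc_nat_pos: "n > 0 \<Longrightarrow> enc_nat n = Node (enc_bool (odd n)) (enc_nat (n div 2))"
  by (simp add: enc_nat_def bits.simps[of n])

lemma enc_nat_eq_Leaf_iff [simp]: "enc_nat n = Leaf \<longleftrightarrow> n = 0"
  using enc_nat_pos[of n] by (cases "n = 0") auto

lemma tdec_enc_nat [simp]: "tdec (enc_nat n) = enc_nat (n - 1)"
proof (induction n rule: less_induct)
  case (less n)
  consider "n = 0" | "n = 1" | m where "n = 2 * m" "m > 0" | m where "n = 2 * m + 1" "m > 0"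
    by (metis gr0I mult_0_right oddE evenE add_0)
  then show ?case
  proof cases
    case (3 m)
    then have "odd (n - 1)" "(n - 1) div 2 = m - 1" "n - 1 > 0" "m < n" by presburger+
    with 3 less.IH[of m] enc_nat_pos[of "n - 1"] show ?thesis
      by (simp add: enc_nat_pos enc_bool_def)
  next
    case (4 m)
    then show ?thesis by (simp add: enc_nat_pos enc_bool_def)
  qed (auto simp: enc_nat_pos enc_bool_def)
qed

text \<open>There are at most \<open>n\<close> bits of at most two nodes each. A linear bound
  suffices, as the kernel is measured against \<open>k + x\<close>.\<close>

lemma size_enc_nat_le: "size (enc_nat n) \<le> 2 * n"
proof (induction n rule: less_induct)
  case (less n)
  show ?case
  proof (cases "n = 0")
    case False
    with less[of "n div 2"] show ?thesis
      by (cases "even n") (auto simp: enc_nat_pos enc_bool_def elim!: evenE oddE)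
  qed simp
qed

text \<open>Clearing a one needs the untouched rest of the list, so the fold carries each tree
  together with its predecessor.\<close>

lemma polytime_fun_tdec:
  assumes "polytime_fun f"
  shows "polytime_fun (\<lambda>x. tdec (f x))"
proof -
  define h where "h l a = Node (Node l (left a)) (if l = Leaf then Node (Node Leaf Leaf) (right a)
    else if left a = Leaf then Leaf else Node Leaf (left a))" for l a
  have fold: "tfoldr h t (Node Leaf Leaf) = Node t (tdec t)" for t
    by (induction t) (auto simp: h_def)
  have size: "size (tdec t) \<le> 2 * size t" for t
    by (induction t) auto
  from polytime_fun_size[OF assms] obtain p where p: "\<And>x. size (f x) \<le> poly p (size x)" by blast
  have "polytime_fun (\<lambda>x. right (tfoldr h (f x) (Node Leaf Leaf)))"
  proof (intro polytime_fun_right polytime_fun_tfoldr)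
    show "polytime_fun (\<lambda>z. h (left (right z)) (right (right z)))"
      unfolding h_def by (intro polytime_fun_intros)
    show "size (tfoldr h l (Node Leaf Leaf)) \<le> poly (1 + 3 * p) (size x)"
      if "size l \<le> size (f x)" for x l
      using that p[of x] size[of l] by (simp add: fold)
  qed (intro assms polytime_fun_intros)+
  then show ?thesis by (simp add: fold)
qed

text \<open>A zero bit is charged like a one, so that a borrow, which turns the former into the
  latter, does not raise the total.\<close>

fun weight :: "dtree \<Rightarrow> nat" where
  "weight Leaf = 0"
| "weight (Node l r) = 1 + max 1 (size l) + weight r"

lemma size_le_weight: "size t \<le> weight t"
  by (induction t) auto

lemma weight_le_size: "weight t \<le> 2 * size t"
  by (induction t) auto

lemma weight_tdec_le: "weight (tdec t) \<le> weight t"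
  by (induction t) auto

text \<open>The state packs a unary counter with what remains of \<open>k\<close> and
  \<open>x\<close>. A step moves one unit to the counter, from \<open>k\<close> first, so the sum is
  never formed.\<close>

definition min_step :: "dtree \<Rightarrow> dtree" where
  "min_step a = (if left (right a) = Leaf
     then if right (right a) = Leaf then a
       else Node (Node Leaf (left a)) (Node Leaf (tdec (right (right a))))
     else Node (Node Leaf (left a)) (Node (tdec (left (right a))) (right (right a))))"

lemma min_step_Node:
  "min_step (Node u (Node k x)) = (if k = Leaf
     then if x = Leaf then Node u (Node k x) else Node (Node Leaf u) (Node Leaf (tdec x))
     else Node (Node Leaf u) (Node (tdec k) x))"
  by (simp add: min_step_def)

definition tmin_sum :: "dtree \<Rightarrow> dtree \<Rightarrow> dtree \<Rightarrow> dtree" where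
  "tmin_sum t k x = left (tfoldr (\<lambda>_. min_step) t (Node Leaf (Node k x)))"

lemma tmin_sum_enc_list:
  "tmin_sum (enc_list ts) (enc_nat k) (enc_nat x) = unary (min (length ts) (k + x))"
proof -
  have "tfoldr (\<lambda>_. min_step) (enc_list ts) (Node Leaf (Node (enc_nat k) (enc_nat x)))
      = Node (unary (min (length ts) (k + x)))
          (Node (enc_nat (k - length ts)) (enc_nat (x - (length ts - k))))"
  proof (induction ts)
    case (Cons t ts)
    \<comment> \<open>Something is left of \<open>k\<close>, or only of \<open>x\<close>, or of
      neither; truncated subtraction lets one formula fit all three.\<close>
    consider "length ts < k" | "k \<le> length ts" "length ts < k + x" | "k + x \<le> length ts"
      by linarith
    then show ?case
      by cases (simp_all add: Cons.IH min_step_Node min_def Suc_diff_le)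
  qed simp
  then show ?thesis by (simp add: tmin_sum_def)
qed

lemma polytime_fun_min_step:
  assumes "polytime_fun f"
  shows "polytime_fun (\<lambda>x. min_step (f x))"
  unfolding min_step_def by (intro assms polytime_fun_intros polytime_fun_tdec)

lemma polytime_fun_tmin_sum:
  assumes f: "polytime_fun f" and g: "polytime_fun g" and h: "polytime_fun h"
  shows "polytime_fun (\<lambda>x. tmin_sum (f x) (g x) (h x))"
proof -
  \<comment> \<open>2 stands for the pair nodes; the unary counter has its plain size and the binary
    numbers their \<open>weight\<close>. Only the counter grows, by one per step.\<close>
  define \<Phi> where "\<Phi> a = 2 + size (left a) + weight (left (right a)) + weight (right (right a))" for a
  have "\<Phi> (min_step a) \<le> \<Phi> a + poly 1 (size x + size l)" for a x l :: dtree
    using weight_tdec_le[of "left (right a)"] weight_tdec_le[of "right (right a)"]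
    by (simp add: \<Phi>_def min_step_def)
  moreover have "size a \<le> \<Phi> a" for a
    using size_le_weight[of "left (right a)"] size_le_weight[of "right (right a)"]
    by (cases a; cases "right a") (simp_all add: \<Phi>_def)
  moreover have "\<Phi> a \<le> poly [:2,2:] (size a)" for a
    using weight_le_size[of "left (right a)"] weight_le_size[of "right (right a)"]
    by (cases a; cases "right a") (simp_all add: \<Phi>_def)
  ultimately show ?thesis
    unfolding tmin_sum_def
    by (intro polytime_fun_left polytime_fun_tfoldr_potential[where \<Phi> = \<Phi> and r = 1 and r' = "[:2,2:]"])
      (intro polytime_fun_intros polytime_fun_min_step f g h | assumption)+
qed


subsection \<open>The kernel of an adjacency matrix\<close>

text \<open>Predicates on trees are true on every tree other than \<^const>\<open>Leaf\<close>, as in the machine model.\<close>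

definition tlow :: "dtree \<Rightarrow> dtree \<Rightarrow> dtree" where
  "tlow S row = tfoldr (\<lambda>c a. if c = Leaf then a else right a) row S"

text \<open>Vertices are represented by their rows: zipping the matrix with the row of
  \<open>u\<close> puts the row of each \<open>v\<close> next to the entry for
  \<open>(u, v)\<close>.\<close>

definition tkeep :: "dtree \<Rightarrow> dtree \<Rightarrow> dtree \<Rightarrow> dtree" where
  "tkeep M S row = (if tlow S row = Leaf then Leaf
     else tfoldr (\<lambda>z a. if right z = Leaf then a else if tlow S (left z) = Leaf then a
       else Node Leaf Leaf) (tzip M row) Leaf)"

text \<open>An entry alone does not tell whether its column survives, so it is paired with the row
  of its column vertex; \<open>right\<close> strips that row again.\<close>

definition tsubmatrix :: "dtree \<Rightarrow> dtree \<Rightarrow> dtree" where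
  "tsubmatrix M S = tmap (\<lambda>row. tmap right (tfilter (\<lambda>z. tkeep M S (left z)) (tzip M row)))
     (tfilter (\<lambda>row. tkeep M S row) M)"

text \<open>\<^const>\<open>Leaf\<close> stands for a negative result, \<open>Node Leaf b\<close> for the number \<open>b\<close>.\<close>

definition tbudget :: "dtree \<Rightarrow> dtree \<Rightarrow> dtree \<Rightarrow> dtree" where
  "tbudget M S k = tfoldr (\<lambda>row a. if tlow S row = Leaf
     then if right a = Leaf then Leaf else Node Leaf (tdec (right a)) else a) M (Node Leaf k)"

definition tdrop :: "dtree \<Rightarrow> dtree \<Rightarrow> dtree" where
  "tdrop S M = tfoldr (\<lambda>_. right) S M"

text \<open>Dropping \<open>n\<close> elements \<open>n\<close> times compares a length with a
  square without multiplication.\<close>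

definition tdrop_square :: "dtree \<Rightarrow> dtree \<Rightarrow> dtree" where
  "tdrop_square S M = tfoldr (\<lambda>_. tdrop S) S M"

text \<open>A single edge with both budgets zero: the fixed answer to rejected inputs.\<close>

definition no_instance :: cnc_inst where
  "no_instance = (\<lparr>pverts = {0, 1}, parcs = {(0, 1), (1, 0)}\<rparr>, 0, 0)"

definition tkernel :: "dtree \<Rightarrow> dtree \<Rightarrow> dtree \<Rightarrow> dtree" where
  "tkernel S M kx = (if tbudget M S (left kx) = Leaf then enc_cnc no_instance
     else if tdrop_square S (tsubmatrix M S) = Leaf
       then Node (tsubmatrix M S) (Node (right (tbudget M S (left kx))) (right kx))
       else enc_cnc no_instance)"

text \<open>The extra \<open>Node Leaf\<close> adds one to the unary threshold: \<open>tlow\<close>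
  tests strict inequality, so degree at most \<open>d\<close> is tested with
  \<open>d + 1\<close>.\<close>

definition treduce :: "dtree \<Rightarrow> dtree" where
  "treduce t = tkernel (Node Leaf (tmin_sum (left t) (left (right t)) (right (right t))))
     (left t) (right t)"

section \<open>Running times of the kernel functions\<close>

lemma polytime_fun_tlow:
  assumes f: "polytime_fun f" and g: "polytime_fun g"
  shows "polytime_fun (\<lambda>x. tlow (f x) (g x))"
  unfolding tlow_def
  by (rule polytime_fun_tfoldr_size[where r = 0])
    ((intro f g polytime_fun_intros)+, simp add: size_right_le)

lemma polytime_fun_tkeep:
  assumes f: "polytime_fun f" and g: "polytime_fun g" and h: "polytime_fun h"
  shows "polytime_fun (\<lambda>x. tkeep (f x) (g x) (h x))"
  unfolding tkeep_def
  by (intro polytime_fun_if_Leaf polytime_fun_tfoldr_size[where r = 1])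
    ((intro f g h polytime_fun_intros polytime_fun_tlow polytime_fun_tzip
      polytime_fun_compose[OF g])+, simp)

lemma polytime_fun_tsubmatrix:
  assumes f: "polytime_fun f" and g: "polytime_fun g"
  shows "polytime_fun (\<lambda>x. tsubmatrix (f x) (g x))"
  unfolding tsubmatrix_def
  by (intro f g polytime_fun_intros polytime_fun_tmap polytime_fun_tfilter polytime_fun_tkeep
    polytime_fun_tzip polytime_fun_compose[OF f] polytime_fun_compose[OF g])

lemma polytime_fun_tbudget:
  assumes f: "polytime_fun f" and g: "polytime_fun g" and h: "polytime_fun h"
  shows "polytime_fun (\<lambda>x. tbudget (f x) (g x) (h x))"
proof -
  \<comment> \<open>1 stands for the pair node and \<open>weight\<close> measures the binary budget,
    which is only decremented; no step raises this, hence \<open>r = 0\<close>.\<close>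
  define \<Phi> where "\<Phi> a = 1 + size (left a) + weight (right a)" for a
  have "\<Phi> (if tlow (g x) l = Leaf then if right a = Leaf then Leaf else Node Leaf (tdec (right a))
      else a) \<le> \<Phi> a + poly 0 (size x + size l)" for x l a
    using weight_tdec_le[of "right a"] by (simp add: \<Phi>_def)
  moreover have "size a \<le> \<Phi> a" for a
    using size_le_weight[of "right a"] by (cases a) (simp_all add: \<Phi>_def)
  moreover have "\<Phi> a \<le> poly [:1,2:] (size a)" for a
    using weight_le_size[of "right a"] by (cases a) (simp_all add: \<Phi>_def)
  ultimately show ?thesis
    unfolding tbudget_def
    by (intro polytime_fun_tfoldr_potential[where \<Phi> = \<Phi> and r = 0 and r' = "[:1,2:]"])
      (intro polytime_fun_intros polytime_fun_tdec polytime_fun_tlow polytime_fun_compose[OF g]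
        f h | assumption)+
qed

lemma size_tdrop_le: "size (tdrop S M) \<le> size M"
  unfolding tdrop_def by (induction S) (auto intro: le_trans[OF size_right_le])

lemma polytime_fun_tdrop:
  assumes f: "polytime_fun f" and g: "polytime_fun g"
  shows "polytime_fun (\<lambda>x. tdrop (f x) (g x))"
  unfolding tdrop_def
  by (rule polytime_fun_tfoldr_size[where r = 0])
    ((intro f g polytime_fun_intros)+, simp add: size_right_le)

lemma polytime_fun_tdrop_square:
  assumes f: "polytime_fun f" and g: "polytime_fun g"
  shows "polytime_fun (\<lambda>x. tdrop_square (f x) (g x))"
  unfolding tdrop_square_def
  by (rule polytime_fun_tfoldr_size[where r = 0])
    ((intro f g polytime_fun_intros polytime_fun_tdrop polytime_fun_compose[OF f])+,
      simp add: size_tdrop_le)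

lemma polytime_fun_tkernel:
  assumes f: "polytime_fun f" and g: "polytime_fun g" and h: "polytime_fun h"
  shows "polytime_fun (\<lambda>x. tkernel (f x) (g x) (h x))"
  unfolding tkernel_def
  by (intro f g h polytime_fun_intros polytime_fun_tbudget polytime_fun_tdrop_square
    polytime_fun_tsubmatrix)

lemma polytime_fun_treduce: "polytime_fun treduce"
  unfolding treduce_def[abs_def]
  by (intro polytime_fun_intros polytime_fun_tkernel polytime_fun_tmin_sum)

section \<open>Values of the kernel functions on adjacency matrices\<close>

text \<open>Relation and vertex list are separate, so the list can be filtered while the relation
  stays fixed.\<close>

definition enc_row :: "('a \<Rightarrow> 'a \<Rightarrow> bool) \<Rightarrow> 'a list \<Rightarrow> 'a \<Rightarrow> dtree" where
  "enc_row E vs u = enc_list (map (\<lambda>v. enc_bool (E u v)) vs)"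

definition enc_matrix :: "('a \<Rightarrow> 'a \<Rightarrow> bool) \<Rightarrow> 'a list \<Rightarrow> dtree" where
  "enc_matrix E vs = enc_list (map (enc_row E vs) vs)"

lemma enc_bool_eq_Leaf_iff [simp]: "enc_bool b = Leaf \<longleftrightarrow> \<not> b"
  by (simp add: enc_bool_def)

lemma tlow_enc_row: "tlow (unary m) (enc_row E vs u) = unary (m - length (filter (E u) vs))"
  unfolding tlow_def enc_row_def by (induction vs) auto

lemma tkeep_enc_row:
  "tkeep (enc_matrix E vs) (unary m) (enc_row E vs u) \<noteq> Leaf \<longleftrightarrow>
     length (filter (E u) vs) < m \<and> (\<exists>v\<in>set vs. E u v \<and> length (filter (E v) vs) < m)"
proof -
  have "tfoldr (\<lambda>z a. if right z = Leaf then a else if tlow (unary m) (left z) = Leaf then a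
      else Node Leaf Leaf) (enc_list (map (\<lambda>v. Node (enc_row E vs v) (enc_bool (E u v))) us)) Leaf
      \<noteq> Leaf \<longleftrightarrow> (\<exists>v\<in>set us. E u v \<and> length (filter (E v) vs) < m)" for us
    by (induction us) (auto simp: tlow_enc_row)
  moreover have "tzip (enc_matrix E vs) (enc_row E vs u)
      = enc_list (map (\<lambda>v. Node (enc_row E vs v) (enc_bool (E u v))) vs)"
    by (simp only: enc_matrix_def enc_row_def[of E vs u] tzip_enc_list)
  ultimately show ?thesis by (simp add: tkeep_def tlow_enc_row not_le)
qed

lemma tsubmatrix_enc_matrix:
  assumes "\<And>u. u \<in> set vs \<Longrightarrow> keep u \<longleftrightarrow>
    length (filter (E u) vs) < m \<and> (\<exists>v\<in>set vs. E u v \<and> length (filter (E v) vs) < m)"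
  shows "tsubmatrix (enc_matrix E vs) (unary m) = enc_matrix E (filter keep vs)"
proof -
  have keep: "filter (\<lambda>u. tkeep (enc_matrix E vs) (unary m) (enc_row E vs u) \<noteq> Leaf) vs
      = filter keep vs"
    by (intro filter_cong) (auto simp: tkeep_enc_row assms)
  \<comment> \<open>Matrix and row are maps over the same \<open>vs\<close>, so zipping is pointwise
    and columns are filtered as rows are.\<close>
  have "tmap right (tfilter (\<lambda>z. tkeep (enc_matrix E vs) (unary m) (left z))
      (tzip (enc_matrix E vs) (enc_row E vs u))) = enc_row E (filter keep vs) u" for u
    by (simp only: enc_matrix_def[of E vs] enc_row_def[of E vs u] tzip_enc_list tfilter_enc_list
        tmap_enc_list left.simps right.simps)
      (simp add: keep enc_row_def[of E "filter keep vs"] flip: enc_matrix_def)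
  moreover have "tfilter (tkeep (enc_matrix E vs) (unary m)) (enc_matrix E vs)
      = enc_list (map (enc_row E vs) (filter keep vs))"
    using keep by (subst (2) enc_matrix_def) (simp add: tfilter_enc_list)
  ultimately show ?thesis
    by (simp add: tsubmatrix_def tmap_enc_list enc_matrix_def[of E "filter keep vs"])
qed

lemma tbudget_enc_matrix:
  fixes E vs m
  defines "h \<equiv> length (filter (\<lambda>u. m \<le> length (filter (E u) vs)) vs)"
  shows "tbudget (enc_matrix E vs) (unary m) (enc_nat k)
    = (if h \<le> k then Node Leaf (enc_nat (k - h)) else Leaf)"
proof -
  \<comment> \<open>The induction is over the rows only; degrees still refer to all of
    \<open>vs\<close>. Once \<open>Leaf\<close>, the accumulator stays \<open>Leaf\<close>.\<close>
  have "tbudget (enc_list (map (enc_row E vs) us)) (unary m) (enc_nat k)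
      = (let h = length (filter (\<lambda>u. m \<le> length (filter (E u) vs)) us)
         in if h \<le> k then Node Leaf (enc_nat (k - h)) else Leaf)" for us
    by (induction us) (auto simp: tbudget_def tlow_enc_row Let_def Suc_diff_le)
  then show ?thesis by (simp add: enc_matrix_def h_def Let_def)
qed

lemma tdrop_unary: "tdrop (unary n) (enc_list ts) = enc_list (drop n ts)"
proof (induction n)
  case (Suc n)
  then show ?case
    by (cases "drop n ts") (auto simp: tdrop_def drop_Suc simp flip: tl_drop)
qed (simp add: tdrop_def)

lemma tdrop_square_eq_Leaf_iff:
  "tdrop_square (unary n) (enc_list ts) = Leaf \<longleftrightarrow> length ts \<le> n * n"
proof -
  have "tfoldr (\<lambda>_. tdrop (unary n)) (unary j) (enc_list ts) = enc_list (drop (j * n) ts)" for j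
    by (induction j) (auto simp: tdrop_unary add.commute)
  moreover have "enc_list us = Leaf \<longleftrightarrow> us = []" for us by (cases us) auto
  ultimately show ?thesis by (simp add: tdrop_square_def)
qed


section \<open>Correctness and size of the kernel\<close>

definition linked_pairs :: "'a rel \<Rightarrow> 'a set \<Rightarrow> 'a rel" where
  "linked_pairs E W = (E \<inter> W \<times> W)\<^sup>+ - Id"

lemma linked_pairs_subset: "linked_pairs E W \<subseteq> W \<times> W"
  unfolding linked_pairs_def using trancl_subset_Sigma[of "E \<inter> W \<times> W" W] by blast

text \<open>Comparing the restricted relations instead of the vertex sets allows isolated vertices
  of \<open>W\<close> to be missing from \<open>W'\<close>.\<close>

lemma linked_pairs_mono: "E \<inter> W \<times> W \<subseteq> E' \<inter> W' \<times> W' \<Longrightarrow> linked_pairs E W \<subseteq> linked_pairs E' W'"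
  unfolding linked_pairs_def by (intro Diff_mono trancl_mono_subset order_refl)

lemma finite_linked_pairs: "finite W \<Longrightarrow> finite (linked_pairs E W)"
  by (rule finite_subset[OF linked_pairs_subset]) simp

context pair_graph
begin

text \<open>Reachability is symmetric here, so strong components are its classes; between distinct
  vertices it coincides with the transitive closure of the arcs.\<close>

lemma connected_pairs_induce_subgraph:
  assumes "W \<subseteq> pverts G"
  shows "connected_pairs (with_proj G \<restriction> W) = linked_pairs (parcs G) W"
proof -
  interpret H: sym_digraph "with_proj G \<restriction> W"
    by (rule induced_graph_imp_graph) (use induced_induce assms in auto)
  have ends: "arcs_ends (with_proj G \<restriction> W) = parcs G \<inter> W \<times> W"
    by (auto simp: arcs_ends_conv)
  have "(\<exists>S\<in>H.sccs_verts. u \<in> S \<and> v \<in> S) \<longleftrightarrow> (u, v) \<in> (parcs G \<inter> W \<times> W)\<^sup>+" if "u \<noteq> v" for u v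
  proof
    assume "\<exists>S\<in>H.sccs_verts. u \<in> S \<and> v \<in> S"
    then have "u \<rightarrow>\<^sup>*\<^bsub>with_proj G \<restriction> W\<^esub> v" by (auto simp: H.in_sccs_verts_conv_reachable)
    with that show "(u, v) \<in> (parcs G \<inter> W \<times> W)\<^sup>+" using H.reachable_neq_reachable1 ends by metis
  next
    assume "(u, v) \<in> (parcs G \<inter> W \<times> W)\<^sup>+"
    then have uv: "u \<rightarrow>\<^sup>*\<^bsub>with_proj G \<restriction> W\<^esub> v" using H.reachable1_reachable ends by metis
    then have "u \<in> H.scc_of u" "v \<in> H.scc_of u" "H.scc_of u \<in> H.sccs_verts"
      using H.symmetric_reachable' H.reachable_in_verts(1) H.in_scc_of_self H.scc_of_in_sccs_verts
      by (auto simp: H.scc_of_def)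
    then show "\<exists>S\<in>H.sccs_verts. u \<in> S \<and> v \<in> S" by blast
  qed
  then show ?thesis by (auto simp: connected_pairs_def linked_pairs_def)
qed

section \<open>Vertex degrees and solutions\<close>

definition degree :: "'a \<Rightarrow> nat" where
  "degree u = card {v. (u, v) \<in> parcs G}"

lemma finite_neighbours: "finite {v. (u, v) \<in> parcs G}"
  by (rule finite_subset[OF _ pair_finite_verts]) (auto dest: in_arcsD2)

lemma degree_le_card: "degree u \<le> card (pverts G)"
  unfolding degree_def by (rule card_mono[OF pair_finite_verts]) (auto dest: in_arcsD2)

text \<open>Every neighbour of \<open>u\<close> lies in \<open>C\<close> or ends a linked pair that
  starts at \<open>u\<close>; absence of loops keeps that pair off the diagonal.\<close>

lemma degree_le_of_notin_cut:
  assumes C: "C \<subseteq> pverts G" and u: "u \<in> pverts G - C"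
  shows "degree u \<le> card C + card (linked_pairs (parcs G) (pverts G - C))"
proof -
  let ?W = "pverts G - C"
  have fin: "finite C" "finite ?W"
    using finite_subset[OF C pair_finite_verts] pair_finite_verts by auto
  have "{v. (u, v) \<in> parcs G} \<subseteq> C \<union> snd ` linked_pairs (parcs G) ?W"
  proof
    fix v
    assume "v \<in> {v. (u, v) \<in> parcs G}"
    then have uv: "(u, v) \<in> parcs G" by simp
    show "v \<in> C \<union> snd ` linked_pairs (parcs G) ?W"
    proof (cases "v \<in> C")
      case False
      with uv u have "(u, v) \<in> linked_pairs (parcs G) ?W"
        by (auto simp: linked_pairs_def no_loops' dest: in_arcsD2)
      then show ?thesis by force
    qed simp
  qed
  then have "degree u \<le> card (C \<union> snd ` linked_pairs (parcs G) ?W)"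
    unfolding degree_def using fin finite_linked_pairs[OF fin(2)] by (intro card_mono) auto
  also have "\<dots> \<le> card C + card (snd ` linked_pairs (parcs G) ?W)" by (rule card_Un_le)
  also have "\<dots> \<le> card C + card (linked_pairs (parcs G) ?W)"
    using card_image_le[OF finite_linked_pairs[OF fin(2)]] by simp
  finally show ?thesis .
qed

definition low :: "nat \<Rightarrow> 'a set" where
  "low d = {u \<in> pverts G. degree u \<le> d}"

text \<open>These are the vertices that are not isolated in the subgraph induced on
  \<open>low d\<close>.\<close>

definition core :: "nat \<Rightarrow> 'a set" where
  "core d = {u \<in> low d. \<exists>v\<in>low d. (u, v) \<in> parcs G}"

lemma core_subset: "core d \<subseteq> low d" "low d \<subseteq> pverts G"
  by (auto simp: core_def low_def)

lemma pair_graph_induce: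
  assumes "W \<subseteq> pverts G"
  shows "pair_graph \<lparr>pverts = W, parcs = parcs G \<inter> W \<times> W\<rparr>"
proof -
  have "finite W" using assms pair_finite_verts finite_subset by blast
  then show ?thesis
    by unfold_locales
      (auto simp: symmetric_def sym_def pair_finite_arcs no_loops' intro: arcs_symmetric)
qed

context
  fixes C k x
  assumes C: "C \<subseteq> pverts G" "card C \<le> k" "card (linked_pairs (parcs G) (pverts G - C)) \<le> x"
begin

lemma high_subset_cut: "pverts G - low (k + x) \<subseteq> C"
proof
  fix u
  assume "u \<in> pverts G - low (k + x)"
  then have "u \<in> pverts G" "\<not> degree u \<le> k + x" by (auto simp: low_def)
  then show "u \<in> C" using degree_le_of_notin_cut[OF C(1), of u] C(2,3) by force
qed

text \<open>A core vertex outside \<open>C\<close> has a low neighbour. If that is outside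
  \<open>C\<close> too, they form a linked pair; otherwise the vertex is among the at most
  \<open>k + x\<close> neighbours of a low vertex of \<open>C\<close>. The count is rounded up to a
  square, the form that \<open>tdrop_square\<close> tests.\<close>

lemma card_core_le: "card (core (k + x)) \<le> (k + x + 1) * (k + x + 1)"
proof -
  let ?V = "core (k + x)" and ?L = "linked_pairs (parcs G) (pverts G - C)"
  let ?N = "\<lambda>v. {u. (v, u) \<in> parcs G}"
  have fin: "finite C" "finite ?L"
    using finite_subset[OF C(1) pair_finite_verts] pair_finite_verts
    by (auto intro: finite_linked_pairs)
  have "?V \<subseteq> C \<union> fst ` ?L \<union> (\<Union>v \<in> C \<inter> low (k + x). ?N v)"
  proof
    fix u
    assume u: "u \<in> ?V"
    then obtain v where v: "v \<in> low (k + x)" "(u, v) \<in> parcs G" by (auto simp: core_def)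
    show "u \<in> C \<union> fst ` ?L \<union> (\<Union>v \<in> C \<inter> low (k + x). ?N v)"
    proof (cases "u \<in> C \<or> v \<in> C")
      case True
      with v show ?thesis using arcs_symmetric by auto
    next
      case False
      with v have "(u, v) \<in> ?L"
        by (auto simp: linked_pairs_def no_loops' dest: in_arcsD1 in_arcsD2)
      then show ?thesis by force
    qed
  qed
  then have "card ?V \<le> card (C \<union> fst ` ?L \<union> (\<Union>v \<in> C \<inter> low (k + x). ?N v))"
    using fin finite_neighbours by (intro card_mono) auto
  also have "\<dots> \<le> card C + card (fst ` ?L) + card (\<Union>v \<in> C \<inter> low (k + x). ?N v)"
    by (meson add_mono card_Un_le le_trans order_refl)
  also have "card (fst ` ?L) \<le> x"
    using card_image_le[OF fin(2)] C(3) le_trans by blast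
  also have "card (\<Union>v \<in> C \<inter> low (k + x). ?N v) \<le> (\<Sum>v \<in> C \<inter> low (k + x). card (?N v))"
    using fin by (intro card_UN_le) auto
  also have "\<dots> \<le> (\<Sum>v \<in> C \<inter> low (k + x). k + x)"
    by (intro sum_mono) (auto simp: low_def degree_def)
  also have "\<dots> \<le> k * (k + x)"
    using card_mono[OF fin(1), of "C \<inter> low (k + x)"] C(2) by simp
  finally have "card ?V \<le> k + x + k * (k + x)" using C(2) by linarith
  then show ?thesis by (simp add: algebra_simps)
qed

end

text \<open>Every solution contains the high vertices, so they are charged to the budget. Of the
  rest only \<open>core\<close> matters: an arc between low vertices has both ends there.\<close>

lemma cut_core_iff:
  "(\<exists>C \<subseteq> pverts G. card C \<le> k \<and> card (linked_pairs (parcs G) (pverts G - C)) \<le> x) \<longleftrightarrow>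
   card (pverts G - low (k + x)) \<le> k \<and>
   (\<exists>C \<subseteq> core (k + x). card C \<le> k - card (pverts G - low (k + x)) \<and>
      card (linked_pairs (parcs G) (core (k + x) - C)) \<le> x)"
  (is "?lhs \<longleftrightarrow> card ?H \<le> k \<and> (\<exists>C\<subseteq>?V. ?P C)")
proof
  assume ?lhs
  then obtain C where C: "C \<subseteq> pverts G" "card C \<le> k"
    "card (linked_pairs (parcs G) (pverts G - C)) \<le> x" by blast
  have fin: "finite C" using C(1) pair_finite_verts finite_subset by blast
  have H: "?H \<subseteq> C" by (rule high_subset_cut[OF C])
  then have cH: "card ?H \<le> card C" using fin by (rule card_mono[rotated])
  \<comment> \<open>\<open>core\<close> consists of low vertices and so avoids
    \<open>?H\<close>.\<close>
  have "card (C \<inter> ?V) \<le> card (C - ?H)"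
    using fin core_subset by (intro card_mono) auto
  also have "\<dots> = card C - card ?H"
    using H fin by (meson card_Diff_subset finite_subset)
  finally have "card (C \<inter> ?V) \<le> k - card ?H" using C(2) by linarith
  moreover have "card (linked_pairs (parcs G) (?V - C \<inter> ?V))
      \<le> card (linked_pairs (parcs G) (pverts G - C))"
    using pair_finite_verts core_subset[of "k + x"]
    by (intro card_mono finite_linked_pairs linked_pairs_mono) auto
  ultimately have "?P (C \<inter> ?V)" using C(3) by linarith
  then show "card ?H \<le> k \<and> (\<exists>C\<subseteq>?V. ?P C)"
    using cH C(2) by (intro conjI exI[of _ "C \<inter> ?V"]) auto
next
  assume "card ?H \<le> k \<and> (\<exists>C\<subseteq>?V. ?P C)"
  then obtain C where C: "card ?H \<le> k" "C \<subseteq> ?V" "?P C" by blast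
  have "card (?H \<union> C) \<le> card ?H + card C" by (rule card_Un_le)
  then have "card (?H \<union> C) \<le> k" using C by linarith
  moreover have "?H \<union> C \<subseteq> pverts G" using C(2) core_subset[of "k + x"] by blast
  moreover have "finite (?V - C)"
    using pair_finite_verts core_subset[of "k + x"] finite_subset by (metis finite_Diff)
  \<comment> \<open>Low vertices outside \<open>core\<close> are isolated once \<open>?H\<close> is
    gone, so leaving them out loses no pair.\<close>
  then have "card (linked_pairs (parcs G) (pverts G - (?H \<union> C))) \<le> x"
    using C(3) card_mono[OF finite_linked_pairs linked_pairs_mono,
        of "?V - C" "parcs G" "pverts G - (?H \<union> C)" "parcs G"]
    by (force simp: core_def intro: arcs_symmetric)
  ultimately show ?lhs by blast
qed

end

section \<open>The reduction on instances\<close>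

lemma cnc_yes_iff:
  assumes "pair_graph G"
  shows "cnc_yes (G, k, x) \<longleftrightarrow>
    (\<exists>C \<subseteq> pverts G. card C \<le> k \<and> card (linked_pairs (parcs G) (pverts G - C)) \<le> x)"
proof -
  interpret pair_graph G by (rule assms)
  show ?thesis by (simp add: connected_pairs_induce_subgraph)
qed

lemma linked_pairs_induce: "W \<subseteq> V \<Longrightarrow> linked_pairs (E \<inter> V \<times> V) W = linked_pairs E W"
  by (intro equalityI linked_pairs_mono) auto

text \<open>The size test uses the capped \<open>m\<close> that is affordable in unary on trees,
  whereas \<open>core\<close> and \<open>low\<close> refer to the uncapped
  \<open>k + x\<close>.\<close>

fun reduce :: "cnc_inst \<Rightarrow> cnc_inst" where
  "reduce (G, k, x) =
     (let V = pair_graph.core G (k + x); h = card (pverts G - pair_graph.low G (k + x));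
        m = Suc (min (card (pverts G)) (k + x))
      in if h \<le> k \<and> card V \<le> m * m then (\<lparr>pverts = V, parcs = parcs G \<inter> V \<times> V\<rparr>, k - h, x)
        else no_instance)"

lemma pair_graph_no_instance: "pair_graph (fst no_instance)"
  unfolding no_instance_def by unfold_locales (auto simp: symmetric_def sym_def)

lemma not_cnc_yes_no_instance: "\<not> cnc_yes no_instance"
proof
  let ?E = "{(0, 1), (1, 0)} :: nat rel" and ?V = "{0, 1} :: nat set"
  assume "cnc_yes no_instance"
  then obtain C where C: "C \<subseteq> ?V" "card C \<le> 0" "card (linked_pairs ?E (?V - C)) \<le> 0"
    using cnc_yes_iff[OF pair_graph_no_instance, of 0 0] unfolding no_instance_def by auto
  moreover have "finite C" using C(1) finite_subset by blast
  moreover have "finite (linked_pairs ?E (?V - C))" by (simp add: finite_linked_pairs)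
  ultimately have "C = {}" "linked_pairs ?E (?V - C) = {}" by simp_all
  moreover have "(0, 1) \<in> linked_pairs ?E ?V" by (auto simp: linked_pairs_def)
  ultimately show False by simp
qed

lemma reduce_correct:
  assumes "pair_graph G"
  shows "pair_graph (fst (reduce (G, k, x)))" "cnc_yes (reduce (G, k, x)) \<longleftrightarrow> cnc_yes (G, k, x)"
proof -
  interpret pair_graph G by (rule assms)
  let ?V = "core (k + x)" and ?h = "card (pverts G - low (k + x))"
  let ?m = "Suc (min (card (pverts G)) (k + x))"
  let ?G = "\<lparr>pverts = ?V, parcs = parcs G \<inter> ?V \<times> ?V\<rparr>"
  have sub: "?V \<subseteq> pverts G" using core_subset[of "k + x"] by blast
  then have graph: "pair_graph ?G" by (rule pair_graph_induce)
  then show "pair_graph (fst (reduce (G, k, x)))"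
    by (simp add: Let_def pair_graph_no_instance)
  have yes: "cnc_yes (G, k, x) \<longleftrightarrow> ?h \<le> k \<and> cnc_yes (?G, k - ?h, x)"
    unfolding cnc_yes_iff[OF assms] cnc_yes_iff[OF graph] cut_core_iff
    by (simp add: linked_pairs_induce)
  \<comment> \<open>The cap rejects no yes-instance: if \<open>m\<close> is one more than the number
    of vertices, the test holds trivially; otherwise \<open>m = k + x + 1\<close> and
    \<open>card_core_le\<close> applies.\<close>
  have "card ?V \<le> ?m * ?m" if "cnc_yes (G, k, x)"
  proof (cases "card (pverts G) \<le> k + x")
    case True
    have "card ?V \<le> card (pverts G)" using sub pair_finite_verts by (rule card_mono[rotated])
    with True show ?thesis by (simp add: min_def)
  next
    case False
    then show ?thesis using that card_core_le unfolding cnc_yes_iff[OF assms] by (auto simp: min_def)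
  qed
  then show "cnc_yes (reduce (G, k, x)) \<longleftrightarrow> cnc_yes (G, k, x)"
    using yes not_cnc_yes_no_instance by (auto simp: Let_def simp del: cnc_yes.simps)
qed

section \<open>Agreement of the tree function with the reduction\<close>

lemma enc_graph_eq_enc_matrix:
  "enc_graph G = enc_matrix (\<lambda>u v. (u, v) \<in> parcs G) (sorted_list_of_set (pverts G))"
  by (simp add: enc_graph_def enc_matrix_def enc_row_def[abs_def] Let_def)

lemma filter_sorted_list_of_set:
  "finite A \<Longrightarrow> filter P (sorted_list_of_set A) = sorted_list_of_set {a \<in> A. P a}"
  by (intro sorted_distinct_set_unique) (auto simp: sorted_wrt_filter)

lemma treduce_enc:
  assumes "pair_graph G"
  shows "treduce (enc_cnc (G, k, x)) = enc_cnc (reduce (G, k, x))"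
proof -
  interpret pair_graph G by (rule assms)
  let ?V = "core (k + x)" and ?H = "pverts G - low (k + x)"
  define vs where "vs = sorted_list_of_set (pverts G)"
  define E where "E u v \<longleftrightarrow> (u, v) \<in> parcs G" for u v
  define m where "m = Suc (min (card (pverts G)) (k + x))"
  have vs: "set vs = pverts G" "distinct vs" "length vs = card (pverts G)"
    using pair_finite_verts by (simp_all add: vs_def)
  have enc: "enc_graph G = enc_matrix E vs"
    by (simp add: enc_graph_eq_enc_matrix vs_def E_def[abs_def])
  have deg: "length (filter (E u) vs) = degree u" for u
    unfolding degree_def distinct_length_filter[OF vs(2)] vs(1)
    by (rule arg_cong[of _ _ card]) (auto simp: E_def dest: in_arcsD2)
  \<comment> \<open>Degrees never exceed the number of vertices, so capping the threshold there
    changes no comparison.\<close>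
  have lt: "degree u < m \<longleftrightarrow> degree u \<le> k + x" for u
    using degree_le_card[of u] by (auto simp: m_def)
  then have ge: "m \<le> degree u \<longleftrightarrow> \<not> degree u \<le> k + x" for u
    by (metis not_le)
  have S: "Node Leaf (tmin_sum (enc_graph G) (enc_nat k) (enc_nat x)) = unary m"
    unfolding enc enc_matrix_def by (simp add: tmin_sum_enc_list vs m_def)
  have h: "length (filter (\<lambda>u. m \<le> length (filter (E u) vs)) vs) = card ?H"
    unfolding deg ge
    by (auto simp: distinct_length_filter[OF vs(2)] vs(1) low_def intro: arg_cong[of _ _ card])
  have "tsubmatrix (enc_matrix E vs) (unary m) = enc_matrix E (filter (\<lambda>u. u \<in> ?V) vs)"
    by (rule tsubmatrix_enc_matrix) (auto simp: deg lt core_def low_def vs E_def)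
  also have "filter (\<lambda>u. u \<in> ?V) vs = sorted_list_of_set ?V"
    unfolding vs_def filter_sorted_list_of_set[OF pair_finite_verts]
    using core_subset[of "k + x"] by (intro arg_cong[of _ _ sorted_list_of_set]) auto
  finally have sub: "tsubmatrix (enc_matrix E vs) (unary m) = enc_matrix E (sorted_list_of_set ?V)" .
  have "finite ?V" using core_subset[of "k + x"] pair_finite_verts finite_subset by metis
  then have "enc_matrix E (sorted_list_of_set ?V)
      = enc_graph \<lparr>pverts = ?V, parcs = parcs G \<inter> ?V \<times> ?V\<rparr>"
    by (auto simp: enc_graph_eq_enc_matrix enc_matrix_def enc_row_def E_def intro!: arg_cong[of _ _ enc_list])
  moreover have "tdrop_square (unary m) (enc_matrix E (sorted_list_of_set ?V)) = Leaf
      \<longleftrightarrow> card ?V \<le> m * m"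
    by (simp add: enc_matrix_def tdrop_square_eq_Leaf_iff)
  moreover have "tbudget (enc_matrix E vs) (unary m) (enc_nat k)
      = (if card ?H \<le> k then Node Leaf (enc_nat (k - card ?H)) else Leaf)"
    unfolding tbudget_enc_matrix h ..
  ultimately show ?thesis
    by (simp add: treduce_def S tkernel_def flip: m_def)
      (simp add: enc sub Let_def)
qed

section \<open>Size of the kernel\<close>

lemma size_enc_list: "size (enc_list ts) = length ts + sum_list (map size ts)"
  by (induction ts) auto

lemma size_enc_matrix_le: "size (enc_matrix E vs) \<le> length vs * (1 + 2 * length vs)"
proof -
  have bool: "size (enc_bool b) \<le> 1" for b by (simp add: enc_bool_def)
  have row: "size (enc_row E vs u) \<le> 2 * length vs" for u
    using sum_list_mono[of vs "\<lambda>v. size (enc_bool (E u v))" "\<lambda>_. 1"] bool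
    by (simp add: enc_row_def size_enc_list sum_list_triv comp_def)
  show ?thesis
    using sum_list_mono[of vs "\<lambda>u. size (enc_row E vs u)" "\<lambda>_. 2 * length vs"] row
    by (simp add: enc_matrix_def size_enc_list sum_list_triv comp_def algebra_simps)
qed

text \<open>Adding the size of the fixed no-instance avoids a maximum. In
  \<open>2 + 3 * (k + x)\<close>, two nodes pack the triple, \<open>2 * (k + x)\<close> covers the
  binary numbers and \<open>k + x\<close> the new parameter.\<close>

lemma size_reduce_le:
  fixes k x
  defines "N \<equiv> (k + x + 1) * (k + x + 1)"
  shows "size (enc_cnc (reduce (G, k, x))) + cnc_param (reduce (G, k, x))
    \<le> size (enc_cnc no_instance) + (N * (1 + 2 * N) + (2 + 3 * (k + x)))"
proof -
  let ?V = "pair_graph.core G (k + x)" and ?m = "Suc (min (card (pverts G)) (k + x))"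
  let ?h = "card (pverts G - pair_graph.low G (k + x))"
  let ?G = "\<lparr>pverts = ?V, parcs = parcs G \<inter> ?V \<times> ?V\<rparr>"
  have "size (enc_cnc (?G, k - ?h, x)) + cnc_param (?G, k - ?h, x)
      \<le> N * (1 + 2 * N) + (2 + 3 * (k + x))" if "card ?V \<le> ?m * ?m"
  proof -
    have "?m * ?m \<le> N" unfolding N_def by (intro mult_mono) auto
    with that have "length (sorted_list_of_set ?V) \<le> N" by simp
    then have "size (enc_graph ?G) \<le> N * (1 + 2 * N)"
      unfolding enc_graph_eq_enc_matrix
      by (intro le_trans[OF size_enc_matrix_le] mult_mono) auto
    moreover have "size (enc_nat (k - ?h)) \<le> 2 * k" "size (enc_nat x) \<le> 2 * x"
      using size_enc_nat_le[of "k - ?h"] size_enc_nat_le[of x] by linarith+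
    ultimately show ?thesis by simp
  qed
  moreover have "cnc_param no_instance = 0" by (simp add: no_instance_def)
  ultimately show ?thesis
    by (auto simp: Let_def simp del: enc_cnc.simps cnc_param.simps)
qed

theorem theorem4:
  shows "admits_polynomial_kernel cnc_instances enc_cnc cnc_yes cnc_param"
proof -
  let ?N = "\<lambda>n :: nat. (n + 1) * (n + 1)"
  have "poly_bounded (\<lambda>n. size (enc_cnc no_instance) + (?N n * (1 + 2 * ?N n) + (2 + 3 * n)))"
    by (intro poly_bounded_intros)
  then obtain q where q: "\<And>n. size (enc_cnc no_instance) + (?N n * (1 + 2 * ?N n) + (2 + 3 * n))
      \<le> poly q n"
    unfolding poly_bounded_def by blast
  have "polytime_on cnc_instances enc_cnc reduce"
    by (rule polytime_onI[OF polytime_fun_treduce])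
      (auto simp: cnc_instances_def treduce_enc simp del: enc_cnc.simps reduce.simps)
  moreover have "reduce I \<in> cnc_instances \<and> (cnc_yes (reduce I) \<longleftrightarrow> cnc_yes I)"
    if "I \<in> cnc_instances" for I
    using that reduce_correct
    by (cases I) (auto simp: cnc_instances_def split: prod.splits
        simp del: cnc_yes.simps reduce.simps; metis fst_conv)
  moreover have "size (enc_cnc (reduce I)) + cnc_param (reduce I) \<le> poly q (cnc_param I)" for I
  proof (cases I)
    case (fields G k x)
    show ?thesis
      unfolding fields using le_trans[OF size_reduce_le q] by simp
  qed
  ultimately show ?thesis unfolding admits_polynomial_kernel_def by blast
qed

end
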